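(* If $G$ is a polytree, then the ideal $\mathcal{I}^{\leq 3}(G)$ is toric.
   Context: A polytree is a finite directed acyclic graph $G=(V,E)$, $V=\{1,\dots,n\}$, whose underlying undirected graph is a tree. $\mathbb{R}^E$ denotes the set of real $V\times V$ matrices $\Lambda=(\lambda_{ij})$ with $\lambda_{ij}=0$ whenever $i\to j\notin E$. $PD(V)$ is the cone of positive definite symmetric matrices in $\mathbb{R}^{V\times V}$ and $\mathrm{Sym}_3(V)$ is the space of symmetric tensors in $\mathbb{R}^{V\times V\times V}$. The third-order moment model $\mathcal{M}^{\leq 3}(G)\subseteq PD(V)\times\mathrm{Sym}_3(V)$ is the set of all pairs $(S,T)$ with $$S=(I-\Lambda)^{-T}\Omega^{(2)}(I-\Lambda)^{-1},\qquad T=\Omega^{(3)}\bullet(I-\Lambda)^{-1}\bullet(I-\Lambda)^{-1}\bullet(I-\Lambda)^{-1},$$ where $\Omega^{(2)}\in PD(V)$ is diagonal, $\Omega^{(3)}\in\mathrm{Sym}_3(V)$ is diagonal, and $\Lambda\in\mathbb{R}^E$; the Tucker product is $(\Omega\bullet M\bullet M\bullet M)_{ijk}=\sum_{a,b,c}\Omega_{abc}M_{ai}M_{bj}M_{ck}$. The third-order moment ideal $\mathcal{I}^{\leq 3}(G)\subseteq\mathbb{C}[s_{ij},t_{ijk}\mid 1\le i\le j\le k\le n]$ is the ideal of all polynomials in the entries $S=(s_{ij})$, $T=(t_{ijk})$ that vanish on $\mathcal{M}^{\leq 3}(G)$. Here an ideal of a polynomial ring is called toric if it is the kernel of a monomial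 map, i.e. a homomorphism to another polynomial ring sending each variable to a monomial or to zero. *)

theory Defs
  imports "HOL-Analysis.Analysis" "HOL-Library.Poly_Mapping"
begin

section \<open>Polytrees\<close>

text \<open>
  The vertex set is a finite linearly ordered type \<open>'v\<close>, standing for \<open>{1,\<dots>,n}\<close> with
  \<open>n = CARD('v)\<close>; a directed graph on it is its edge set, with \<open>(i, j) \<in> E\<close> for \<open>i \<rightarrow> j\<close>.
\<close>

definition undirected_cycle :: "('v \<times> 'v) set \<Rightarrow> 'v list \<Rightarrow> bool" where
  "undirected_cycle A vs \<longleftrightarrow>
     length vs \<ge> 3 \<and> distinct vs \<and> successively (\<lambda>u v. (u, v) \<in> A) vs \<and> (last vs, hd vs) \<in> A"

text \<open>A simple undirected graph is represented by its symmetric irreflexive adjacency relation.\<close>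

definition undirected_tree :: "('v \<times> 'v) set \<Rightarrow> bool" where
  "undirected_tree A \<longleftrightarrow>
     sym A \<and> irrefl A \<and> (\<forall>u v. (u, v) \<in> A\<^sup>*) \<and> (\<nexists>vs. undirected_cycle A vs)"

text \<open>
  Passing to \<open>E \<union> E\<inverse>\<close> loses no parallel edges: \<open>i \<rightarrow> j\<close> and \<open>j \<rightarrow> i\<close> cannot both occur
  in an acyclic graph.
\<close>

definition polytree :: "('v::finite \<times> 'v) set \<Rightarrow> bool" where
  "polytree E \<longleftrightarrow> acyclic E \<and> undirected_tree (E \<union> E\<inverse>)"


section \<open>The third-order moment model\<close>

definition positive_definite :: "real^'v^'v \<Rightarrow> bool" where
  "positive_definite S \<longleftrightarrow> transpose S = S \<and> (\<forall>x. x \<noteq> 0 \<longrightarrow> x \<bullet> (S *v x) > 0)"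

definition diagonal_matrix :: "real^'v^'v \<Rightarrow> bool" where
  "diagonal_matrix S \<longleftrightarrow> (\<forall>i j. i \<noteq> j \<longrightarrow> S $ i $ j = 0)"

definition symmetric_tensor :: "real^'v^'v^'v \<Rightarrow> bool" where
  "symmetric_tensor T \<longleftrightarrow> (\<forall>i j k. T $ i $ j $ k = T $ j $ i $ k \<and> T $ i $ j $ k = T $ i $ k $ j)"

definition diagonal_tensor :: "real^'v^'v^'v \<Rightarrow> bool" where
  "diagonal_tensor T \<longleftrightarrow> (\<forall>i j k. \<not> (i = j \<and> j = k) \<longrightarrow> T $ i $ j $ k = 0)"

definition tucker ::
  "real^'v^'v^'v \<Rightarrow> real^'v^'v \<Rightarrow> real^'v^'v \<Rightarrow> real^'v^'v \<Rightarrow> real^'v^'v^'v" where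
  "tucker W L M N =
     (\<chi> i j k. \<Sum>a\<in>UNIV. \<Sum>b\<in>UNIV. \<Sum>c\<in>UNIV. W $ a $ b $ c * L $ a $ i * M $ b $ j * N $ c $ k)"

definition edge_matrices :: "('v \<times> 'v) set \<Rightarrow> (real^'v^'v) set" where
  "edge_matrices E = {\<Lambda>. \<forall>i j. (i, j) \<notin> E \<longrightarrow> \<Lambda> $ i $ j = 0}"

definition moment_model :: "('v::finite \<times> 'v) set \<Rightarrow> ((real^'v^'v) \<times> (real^'v^'v^'v)) set" where
  "moment_model E = {(S, T). \<exists>\<Lambda> \<Omega>2 \<Omega>3.
     \<Lambda> \<in> edge_matrices E \<and>
     positive_definite \<Omega>2 \<and> diagonal_matrix \<Omega>2 \<and>
     symmetric_tensor \<Omega>3 \<and> diagonal_tensor \<Omega>3 \<and>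
     S = transpose (matrix_inv (mat 1 - \<Lambda>)) ** \<Omega>2 ** matrix_inv (mat 1 - \<Lambda>) \<and>
     T = tucker \<Omega>3 (matrix_inv (mat 1 - \<Lambda>)) (matrix_inv (mat 1 - \<Lambda>)) (matrix_inv (mat 1 - \<Lambda>))}"


section \<open>Complex polynomial rings and toric ideals\<close>

text \<open>
  A monomial is a finitely supported exponent function \<open>'x \<Rightarrow>\<^sub>0 nat\<close>, written additively, so the
  convolution product of \<open>HOL-Library.Poly_Mapping\<close> is multiplication of polynomials.
\<close>

type_synonym 'x cpoly = "('x \<Rightarrow>\<^sub>0 nat) \<Rightarrow>\<^sub>0 complex"

definition monom_of :: "('x \<Rightarrow>\<^sub>0 nat) \<Rightarrow> 'x cpoly" where
  "monom_of m = Poly_Mapping.single m 1"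

definition Var :: "'x \<Rightarrow> 'x cpoly" where
  "Var x = monom_of (Poly_Mapping.single x 1)"

definition Const :: "complex \<Rightarrow> 'x cpoly" where
  "Const c = Poly_Mapping.single 0 c"

definition poly_ring :: "'x set \<Rightarrow> 'x cpoly set" where
  "poly_ring X = {p. \<forall>m \<in> Poly_Mapping.keys p. Poly_Mapping.keys m \<subseteq> X}"

definition eval_poly :: "('x \<Rightarrow> complex) \<Rightarrow> 'x cpoly \<Rightarrow> complex" where
  "eval_poly v p = (\<Sum>m \<in> Poly_Mapping.keys p.
     Poly_Mapping.lookup p m * (\<Prod>x \<in> Poly_Mapping.keys m. v x ^ Poly_Mapping.lookup m x))"

definition poly_hom :: "'x set \<Rightarrow> 'y set \<Rightarrow> ('x cpoly \<Rightarrow> 'y cpoly) \<Rightarrow> bool" where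
  "poly_hom X Y \<phi> \<longleftrightarrow>
     (\<forall>p \<in> poly_ring X. \<phi> p \<in> poly_ring Y) \<and>
     (\<forall>c. \<phi> (Const c) = Const c) \<and>
     (\<forall>p \<in> poly_ring X. \<forall>q \<in> poly_ring X. \<phi> (p + q) = \<phi> p + \<phi> q \<and> \<phi> (p * q) = \<phi> p * \<phi> q)"

text \<open>Monomials have coefficient one.\<close>

definition monomial_map :: "'x set \<Rightarrow> 'y set \<Rightarrow> ('x cpoly \<Rightarrow> 'y cpoly) \<Rightarrow> bool" where
  "monomial_map X Y \<phi> \<longleftrightarrow>
     poly_hom X Y \<phi> \<and> (\<forall>x \<in> X. \<phi> (Var x) = 0 \<or> (\<exists>m. \<phi> (Var x) = monom_of m))"

text \<open>
  The target is a polynomial ring in finitely many variables; HOL cannot quantify over the type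
  of these, so they are indexed by natural numbers, which is no restriction.
\<close>

definition toric :: "'x set \<Rightarrow> 'x cpoly set \<Rightarrow> bool" where
  "toric X I \<longleftrightarrow> (\<exists>(Y :: nat set) \<phi>. finite Y \<and> monomial_map X Y \<phi> \<and> I = {p \<in> poly_ring X. \<phi> p = 0})"


section \<open>The third-order moment ideal\<close>

datatype 'v moment_var = s_var 'v 'v | t_var 'v 'v 'v

definition moment_vars :: "('v::{finite,linorder}) moment_var set" where
  "moment_vars = {s_var i j | i j. i \<le> j} \<union> {t_var i j k | i j k. i \<le> j \<and> j \<le> k}"

fun moment_entry :: "real^'v^'v \<Rightarrow> real^'v^'v^'v \<Rightarrow> 'v::finite moment_var \<Rightarrow> complex" where
  "moment_entry S T (s_var i j) = of_real (S $ i $ j)"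
| "moment_entry S T (t_var i j k) = of_real (T $ i $ j $ k)"

definition moment_ideal :: "('v::{finite,linorder} \<times> 'v) set \<Rightarrow> 'v moment_var cpoly set" where
  "moment_ideal E = {p \<in> poly_ring moment_vars.
     \<forall>(S, T) \<in> moment_model E. eval_poly (moment_entry S T) p = 0}"

end

theory Submission
  imports Defs
begin

text \<open>
  Directed paths in a polytree are unique, so the entries of \<open>(I - \<Lambda>)\<inverse>\<close> are products of edge
  coefficients along paths. The common ancestors of a set of vertices, if there are any, are
  exactly the ancestors of one of them, the top \<open>t\<close>; hence every moment is the product of
  \<open>s\<^sub>t\<^sub>t\<close> or \<open>t\<^sub>t\<^sub>t\<^sub>t\<close> with the edge coefficients on the paths from \<open>t\<close>, or zero. This is a monomial
  in the parameters \<open>s\<^sub>v\<^sub>v\<close>, \<open>t\<^sub>v\<^sub>v\<^sub>v\<close>, \<open>\<lambda>\<^sub>u\<^sub>v\<close>. These parameters are subject only to the inequalities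
  \<open>s\<^sub>v\<^sub>v > \<Sum>\<^sub>u \<lambda>\<^sub>u\<^sub>v\<^sup>2 s\<^sub>u\<^sub>u\<close> expressing positive error variances. The positive solutions are closed
  under entrywise multiplication, so distinct monomials are linearly independent on them
  and the moment ideal is the kernel of the monomial map.
\<close>

section \<open>Paths and common ancestors in polytrees\<close>

text \<open>Prepending a vertex keeps a path simple, unless the vertex already occurs; then
  everything before that occurrence is cut off.\<close>

lemma rtrancl_imp_distinct_successively:
  assumes "(u, v) \<in> r\<^sup>*"
  shows "\<exists>vs. vs \<noteq> [] \<and> distinct vs \<and> successively (\<lambda>x y. (x, y) \<in> r) vs \<and> hd vs = u \<and> last vs = v"
  using assms
proof (induction rule: converse_rtrancl_induct)
  case base
  show ?case by (intro exI[of _ "[v]"]) simp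
next
  case (step x y)
  then obtain vs where vs: "vs \<noteq> []" "distinct vs" "successively (\<lambda>x y. (x, y) \<in> r) vs"
    "hd vs = y" "last vs = v"
    by blast
  show ?case
  proof (cases "x \<in> set vs")
    case True
    then obtain ys zs where "vs = ys @ x # zs"
      by (meson split_list)
    with vs show ?thesis
      by (intro exI[of _ "x # zs"]) (auto simp: successively_append_iff)
  next
    case False
    with vs step.hyps show ?thesis
      by (intro exI[of _ "x # vs"]) (cases vs, auto)
  qed
qed

text \<open>A simple path from \<open>v\<close> to \<open>u\<close> that avoids the edge between
  them would be closed to a cycle by that edge.\<close>

lemma undirected_tree_bridge:
  assumes tree: "undirected_tree A" and uv: "(u, v) \<in> A"
  shows "(v, u) \<notin> (A - {(u, v), (v, u)})\<^sup>*"
proof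
  let ?r = "A - {(u, v), (v, u)}"
  assume "(v, u) \<in> ?r\<^sup>*"
  then obtain vs where vs: "vs \<noteq> []" "distinct vs" "successively (\<lambda>x y. (x, y) \<in> ?r) vs"
    "hd vs = v" "last vs = u"
    using rtrancl_imp_distinct_successively[of v u ?r] by blast
  have "u \<noteq> v"
    using tree uv by (auto simp: undirected_tree_def irrefl_def)
  \<comment> \<open>One vertex is excluded by \<open>u \<noteq> v\<close>, and two vertices would
    mean that the path is the removed edge itself.\<close>
  with vs have "length vs \<ge> 3"
    by (cases vs rule: remdups_adj.cases; cases "tl (tl vs)") auto
  moreover have "successively (\<lambda>x y. (x, y) \<in> A) vs"
    using vs(3) by (rule successively_mono) auto
  ultimately have "undirected_cycle A vs"
    using vs uv by (simp add: undirected_cycle_def)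
  with tree show False
    by (auto simp: undirected_tree_def)
qed

context
  fixes E :: "('v::finite \<times> 'v) set"
  assumes polytree: "polytree E"
begin

lemma no_back_path: "(u, v) \<in> E \<Longrightarrow> (v, u) \<notin> E\<^sup>*"
  using polytree by (meson acyclic_def polytree_def rtrancl_into_trancl2)

text \<open>A directed path from \<open>a\<close> to \<open>b\<close> through
  \<open>u \<rightarrow> v\<close> would show that \<open>a\<close> reaches \<open>u\<close> and
  \<open>v\<close> reaches \<open>b\<close>. It cannot run through \<open>v \<rightarrow> u\<close>,
  by acyclicity. What remains after removing the edge is symmetric, so the path can also be walked
  backwards.\<close>

lemma path_avoiding_edge:
  assumes "(a, b) \<in> E\<^sup>*" "(u, v) \<in> E" "\<not> ((a, u) \<in> E\<^sup>* \<and> (v, b) \<in> E\<^sup>*)"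
  shows "(a, b) \<in> (E \<union> E\<inverse> - {(u, v), (v, u)})\<^sup>*" "(b, a) \<in> (E \<union> E\<inverse> - {(u, v), (v, u)})\<^sup>*"
proof -
  let ?r = "E \<union> E\<inverse> - {(u, v), (v, u)}"
  show "(a, b) \<in> ?r\<^sup>*"
    using assms(1,3)
  proof (induction rule: rtrancl_induct)
    case base
    show ?case by simp
  next
    case (step x y)
    have "(x, y) \<in> ?r"
      using step.hyps step.prems assms(2) no_back_path[OF assms(2)] by auto
    moreover have "\<not> ((a, u) \<in> E\<^sup>* \<and> (v, x) \<in> E\<^sup>*)"
      using step.hyps step.prems by (meson rtrancl.rtrancl_into_rtrancl)
    ultimately show ?case
      using step.IH by (meson rtrancl.rtrancl_into_rtrancl)
  qed
  moreover have "sym ?r"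
    by (auto simp: sym_def)
  ultimately show "(b, a) \<in> ?r\<^sup>*"
    by (meson sym_rtrancl symD)
qed

text \<open>The two structural facts below are proved by contradiction to this: each assembles a
  walk from the head of an edge back to its tail that never uses the edge.\<close>

lemma no_detour:
  assumes "(u, v) \<in> E"
  shows "(v, u) \<notin> (E \<union> E\<inverse> - {(u, v), (v, u)})\<^sup>*"
  using undirected_tree_bridge[of "E \<union> E\<inverse>" u v] polytree assms by (auto simp: polytree_def)

text \<open>If the parents differed, stepping from \<open>i\<close> to \<open>u'\<close>, climbing
  to \<open>a\<close> and descending to \<open>u\<close> would be a detour around
  \<open>u \<rightarrow> i\<close>.\<close>

lemma unique_parent_below:
  assumes "(a, u) \<in> E\<^sup>*" "(u, i) \<in> E" "(a, u') \<in> E\<^sup>*" "(u', i) \<in> E"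
  shows "u = u'"
proof (rule ccontr)
  assume neq: "u \<noteq> u'"
  let ?r = "E \<union> E\<inverse> - {(u, i), (i, u)}"
  have "(i, u') \<in> ?r\<^sup>*"
    using assms neq no_back_path[OF assms(2)] by (auto intro!: r_into_rtrancl)
  also have "(u', a) \<in> ?r\<^sup>*"
    using path_avoiding_edge[OF assms(3,2)] no_back_path[OF assms(4)] by blast
  also have "(a, u) \<in> ?r\<^sup>*"
    using path_avoiding_edge[OF assms(1,2)] no_back_path[OF assms(2)] by blast
  finally show False
    using no_detour[OF assms(2)] by blast
qed

lemma common_ancestors_two:
  assumes "(a0, i) \<in> E\<^sup>*" "(a0, j) \<in> E\<^sup>*"
  shows "\<exists>t. \<forall>a. ((a, i) \<in> E\<^sup>* \<and> (a, j) \<in> E\<^sup>*) \<longleftrightarrow> (a, t) \<in> E\<^sup>*"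
proof -
  have "wf (E\<inverse>)"
    using polytree by (simp add: finite_acyclic_wf_converse polytree_def)
  \<comment> \<open>A minimal element for the converse relation: \<open>t\<close> is a lowest common
    ancestor, none of whose children is a common ancestor.\<close>
  then obtain t where t: "(t, i) \<in> E\<^sup>*" "(t, j) \<in> E\<^sup>*"
    and max: "\<And>v. (t, v) \<in> E \<Longrightarrow> \<not> ((v, i) \<in> E\<^sup>* \<and> (v, j) \<in> E\<^sup>*)"
    using wfE_min[of "E\<inverse>" a0 "{a. (a, i) \<in> E\<^sup>* \<and> (a, j) \<in> E\<^sup>*}"] assms by auto
  have "(a, t) \<in> E\<^sup>*" if a: "(a, i) \<in> E\<^sup>*" "(a, j) \<in> E\<^sup>*" for a
  proof (rule ccontr)
    assume not: "(a, t) \<notin> E\<^sup>*"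
    \<comment> \<open>Here \<open>t \<noteq> i\<close>, because \<open>a\<close> reaches
      \<open>i\<close> but not \<open>t\<close>; \<open>v\<close> is the first vertex after
      \<open>t\<close> on the way to \<open>i\<close>. The walk \<open>v\<close>, \<open>i\<close>,
      \<open>a\<close>, \<open>j\<close>, \<open>t\<close> then bypasses the edge
      \<open>t \<rightarrow> v\<close>.\<close>
    then obtain v where v: "(t, v) \<in> E" "(v, i) \<in> E\<^sup>*"
      using t a by (metis converse_rtranclE)
    let ?r = "E \<union> E\<inverse> - {(t, v), (v, t)}"
    have "(v, i) \<in> ?r\<^sup>*"
      using path_avoiding_edge[OF v(2,1)] no_back_path[OF v(1)] by blast
    also have "(i, a) \<in> ?r\<^sup>*"
      using path_avoiding_edge[OF a(1) v(1)] not by blast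
    also have "(a, j) \<in> ?r\<^sup>*"
      using path_avoiding_edge[OF a(2) v(1)] not by blast
    also have "(j, t) \<in> ?r\<^sup>*"
      using path_avoiding_edge[OF t(2) v(1)] max v by blast
    finally show False
      using no_detour[OF v(1)] by blast
  qed
  with t show ?thesis
    by (meson rtrancl_trans)
qed

text \<open>Induction on \<open>I\<close>: the top vertex for the smaller set replaces that set, and
  is merged with the new vertex by the case of two.\<close>

lemma common_ancestors:
  assumes "finite I" "I \<noteq> {}" "\<forall>i\<in>I. (a0, i) \<in> E\<^sup>*"
  shows "\<exists>t. \<forall>a. (\<forall>i\<in>I. (a, i) \<in> E\<^sup>*) \<longleftrightarrow> (a, t) \<in> E\<^sup>*"
  using assms
proof (induction rule: finite_ne_induct)
  case (singleton i)
  show ?case by auto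
next
  case (insert i I)
  then obtain t where t: "\<forall>a. (\<forall>i\<in>I. (a, i) \<in> E\<^sup>*) \<longleftrightarrow> (a, t) \<in> E\<^sup>*"
    by auto
  with insert.prems show ?case
    using common_ancestors_two[of a0 i t] by auto
qed

end

section \<open>Path products\<close>

text \<open>In a polytree these are exactly the edges of the unique directed path from
  \<open>a\<close> to \<open>i\<close>, if there is one; no path has to be chosen.\<close>

definition path_edges :: "('v \<times> 'v) set \<Rightarrow> 'v \<Rightarrow> 'v \<Rightarrow> ('v \<times> 'v) set" where
  "path_edges E a i = {(u, v) \<in> E. (a, u) \<in> E\<^sup>* \<and> (v, i) \<in> E\<^sup>*}"

definition path_prod :: "('v \<times> 'v) set \<Rightarrow> ('v \<times> 'v \<Rightarrow> 'a::comm_semiring_1) \<Rightarrow> 'v \<Rightarrow> 'v \<Rightarrow> 'a" where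
  "path_prod E f a i = (if (a, i) \<in> E\<^sup>* then \<Prod>e\<in>path_edges E a i. f e else 0)"

context
  fixes E :: "('v::finite \<times> 'v) set"
  assumes polytree: "polytree E"
begin

lemma path_edges_refl: "path_edges E a a = {}"
  using no_back_path[OF polytree] by (auto simp: path_edges_def) (meson rtrancl_trans)

text \<open>Only one parent of \<open>i\<close> lies below \<open>a\<close>, so every path from
  \<open>a\<close> to \<open>i\<close> ends with the edge \<open>u \<rightarrow> i\<close>.\<close>

lemma path_edges_snoc:
  assumes "(a, u) \<in> E\<^sup>*" "(u, i) \<in> E"
  shows "path_edges E a i = insert (u, i) (path_edges E a u)" "(u, i) \<notin> path_edges E a u"
proof -
  show "path_edges E a i = insert (u, i) (path_edges E a u)"
  proof (intro equalityI subrelI)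
    fix x y
    assume xy: "(x, y) \<in> path_edges E a i"
    show "(x, y) \<in> insert (u, i) (path_edges E a u)"
    proof (cases "y = i")
      case True
      with xy assms show ?thesis
        using unique_parent_below[OF polytree] by (auto simp: path_edges_def)
    next
      case False
      with xy obtain u' where "(y, u') \<in> E\<^sup>*" "(u', i) \<in> E"
        by (auto simp: path_edges_def elim: rtranclE)
      moreover from this xy have "u' = u"
        using unique_parent_below[OF polytree, of a u' i u] assms
        by (auto simp: path_edges_def) (meson converse_rtrancl_into_rtrancl rtrancl_trans)
      ultimately show ?thesis
        using xy by (auto simp: path_edges_def)
    qed
  next
    fix x y
    assume "(x, y) \<in> insert (u, i) (path_edges E a u)"
    with assms show "(x, y) \<in> path_edges E a i"
      by (auto simp: path_edges_def intro: rtrancl_into_rtrancl)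
  qed
  show "(u, i) \<notin> path_edges E a u"
    using no_back_path[OF polytree assms(2)] by (auto simp: path_edges_def)
qed

lemma path_prod_refl: "path_prod E f a a = 1"
  by (simp add: path_prod_def path_edges_refl)

lemma path_prod_snoc:
  assumes "(a, u) \<in> E\<^sup>*" "(u, i) \<in> E"
  shows "path_prod E f a i = path_prod E f a u * f (u, i)"
proof -
  have "(a, i) \<in> E\<^sup>*"
    using assms by (rule rtrancl_into_rtrancl)
  with assms show ?thesis
    using path_edges_snoc[OF assms]
    by (simp add: path_prod_def mult.commute finite)
qed

lemma path_prod_trans:
  assumes "(a, t) \<in> E\<^sup>*" "(t, i) \<in> E\<^sup>*"
  shows "path_prod E f a i = path_prod E f a t * path_prod E f t i"
  using assms(2)
proof (induction rule: rtrancl_induct)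
  case base
  show ?case by (simp add: path_prod_refl)
next
  case (step u i)
  have "(a, u) \<in> E\<^sup>*"
    using assms(1) step.hyps(1) by (rule rtrancl_trans)
  with step show ?case
    by (simp add: path_prod_snoc mult.assoc)
qed

text \<open>Positivity of \<open>n\<close> preserves the default value 0 for unreachable
  pairs.\<close>

lemma path_prod_power: "n > 0 \<Longrightarrow> path_prod E (\<lambda>e. f e ^ n) a i = path_prod E f a i ^ n"
  by (simp add: path_prod_def prod_power_distrib zero_power)

text \<open>The entrywise form of \<open>M = I + M \<Lambda>\<close> for the matrix \<open>M\<close>
  of path products. At most one summand is nonzero, since only one parent of \<open>i\<close> is
  reachable from \<open>a\<close>.\<close>

lemma path_prod_recursion:
  "path_prod E f a i = of_bool (a = i) + (\<Sum>u | (u, i) \<in> E. path_prod E f a u * f (u, i))"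
proof (cases "(a, i) \<in> E\<^sup>+")
  case True
  then obtain u where u: "(a, u) \<in> E\<^sup>*" "(u, i) \<in> E"
    by (meson tranclD2)
  have "a \<noteq> i"
    using no_back_path[OF polytree] u by blast
  have "(\<Sum>u' | (u', i) \<in> E. path_prod E f a u' * f (u', i)) =
      (\<Sum>u'\<in>{u}. path_prod E f a u' * f (u', i))"
    using u unique_parent_below[OF polytree]
    by (intro sum.mono_neutral_right) (auto simp: path_prod_def)
  with u \<open>a \<noteq> i\<close> show ?thesis
    by (simp add: path_prod_snoc)
next
  case False
  then have "(\<Sum>u | (u, i) \<in> E. path_prod E f a u * f (u, i)) = 0"
    by (intro sum.neutral) (auto simp: path_prod_def dest: rtrancl_into_trancl1)
  with False show ?thesis
    by (cases "a = i") (simp_all add: path_prod_refl, auto simp: path_prod_def dest: rtranclD)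
qed

end

section \<open>Monomial parametrizations\<close>

text \<open>Dedekind's argument; it needs only a multiplicatively closed set of points, without a unit.\<close>

lemma sum_independent_characters:
  fixes ch :: "'m \<Rightarrow> 'w \<Rightarrow> 'a::idom"
  assumes "finite M"
    and "\<And>m v w. v \<in> G \<Longrightarrow> w \<in> G \<Longrightarrow> op v w \<in> G \<and> ch m (op v w) = ch m v * ch m w"
    and "\<And>m m'. m \<in> M \<Longrightarrow> m' \<in> M \<Longrightarrow> m \<noteq> m' \<Longrightarrow> \<exists>w\<in>G. ch m w \<noteq> ch m' w"
    and "\<And>m. m \<in> M \<Longrightarrow> \<exists>w\<in>G. ch m w \<noteq> 0"
    and "\<And>w. w \<in> G \<Longrightarrow> (\<Sum>m\<in>M. c m * ch m w) = 0"
    and "m \<in> M"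
  shows "c m = 0"
  using assms(1,3-)
proof (induction M arbitrary: c m rule: finite_induct)
  case empty
  then show ?case by simp
next
  case (insert m0 M)
  have zero: "c m = 0" if m: "m \<in> M" for m
  proof -
    from m insert.hyps(2) have "m \<noteq> m0" by blast
    with m insert.prems(1)[of m m0] obtain w0 where w0: "w0 \<in> G" "ch m w0 \<noteq> ch m0 w0"
      by blast
    \<comment> \<open>The relation at \<open>op w0 w\<close> minus \<open>ch m0 w0\<close> times the
      relation at \<open>w\<close>: the term of \<open>m0\<close> cancels and a relation over
      \<open>M\<close> remains.\<close>
    have "(\<Sum>m\<in>M. (c m * (ch m w0 - ch m0 w0)) * ch m w) = 0" if w: "w \<in> G" for w
    proof -
      have "(\<Sum>m\<in>M. (c m * (ch m w0 - ch m0 w0)) * ch m w) =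
          (\<Sum>m\<in>insert m0 M. (c m * (ch m w0 - ch m0 w0)) * ch m w)"
        using insert.hyps by simp
      also have "\<dots> = (\<Sum>m\<in>insert m0 M. c m * ch m (op w0 w))
          - ch m0 w0 * (\<Sum>m\<in>insert m0 M. c m * ch m w)"
        using assms(2)[OF w0(1) w]
        by (simp only: sum_distrib_left sum_subtractf [symmetric])
          (intro sum.cong refl, simp add: algebra_simps)
      also have "\<dots> = 0"
        using insert.prems(3)[OF w] insert.prems(3)[of "op w0 w"] assms(2)[OF w0(1) w]
        by simp
      finally show ?thesis .
    qed
    then have "c m * (ch m w0 - ch m0 w0) = 0"
      using insert.IH[of "\<lambda>m. c m * (ch m w0 - ch m0 w0)" m] insert.prems(1,2) m by blast
    with w0 show ?thesis by simp
  qed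
  moreover have "c m0 = 0"
  proof -
    obtain w where w: "w \<in> G" "ch m0 w \<noteq> 0"
      using insert.prems(2) by blast
    have "(\<Sum>m\<in>M. c m * ch m w) = 0"
      using zero by simp
    with insert.prems(3)[OF w(1)] insert.hyps w(2) show ?thesis by simp
  qed
  ultimately show ?case using insert.prems(4) by blast
qed

section \<open>Evaluation and substitution of polynomials\<close>

definition monomial_value :: "('x \<Rightarrow> 'b::comm_monoid_mult) \<Rightarrow> ('x \<Rightarrow>\<^sub>0 nat) \<Rightarrow> 'b" where
  "monomial_value v m = (\<Prod>x\<in>Poly_Mapping.keys m. v x ^ Poly_Mapping.lookup m x)"

text \<open>The coefficient map \<open>h\<close> allows one treatment of two uses: the identity
  gives evaluation at a point, and \<open>Const\<close> gives substitution into another polynomial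
  ring.\<close>

definition subst_poly ::
  "(complex \<Rightarrow> 'b::comm_ring_1) \<Rightarrow> ('x \<Rightarrow> 'b) \<Rightarrow> 'x cpoly \<Rightarrow> 'b" where
  "subst_poly h v p =
     (\<Sum>m\<in>Poly_Mapping.keys p. h (Poly_Mapping.lookup p m) * monomial_value v m)"

lemma monomial_value_superset:
  assumes "finite A" "Poly_Mapping.keys m \<subseteq> A"
  shows "monomial_value v m = (\<Prod>x\<in>A. v x ^ Poly_Mapping.lookup m x)"
  unfolding monomial_value_def using assms
  by (intro prod.mono_neutral_left) (auto simp: in_keys_iff)

lemma monomial_value_zero [simp]: "monomial_value v 0 = 1"
  by (simp add: monomial_value_def)

lemma monomial_value_single [simp]: "monomial_value v (Poly_Mapping.single x n) = v x ^ n"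
  by (simp add: monomial_value_superset[of "{x}"])

lemma monomial_value_add:
  "monomial_value v (m + m') = monomial_value v m * monomial_value v m'"
proof -
  let ?A = "Poly_Mapping.keys m \<union> Poly_Mapping.keys m'"
  have "Poly_Mapping.keys (m + m') \<subseteq> ?A"
    by (rule keys_add)
  then show ?thesis
    by (simp add: monomial_value_superset[of ?A] lookup_add power_add prod.distrib)
qed

lemma subst_poly_superset:
  assumes "h 0 = 0" "finite A" "Poly_Mapping.keys p \<subseteq> A"
  shows "subst_poly h v p = (\<Sum>m\<in>A. h (Poly_Mapping.lookup p m) * monomial_value v m)"
  unfolding subst_poly_def using assms
  by (intro sum.mono_neutral_left) (auto simp: in_keys_iff)

lemma poly_mapping_eq_sum_single:
  "p = (\<Sum>m\<in>Poly_Mapping.keys p. Poly_Mapping.single m (Poly_Mapping.lookup p m))"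
  by (rule poly_mapping_eqI) (auto simp: lookup_sum lookup_single when_def in_keys_iff)

locale coefficient_hom =
  fixes h :: "complex \<Rightarrow> 'b::comm_ring_1"
  assumes zero: "h 0 = 0" and one: "h 1 = 1"
    and add: "h (a + b) = h a + h b" and mult: "h (a * b) = h a * h b"
begin

lemma subst_poly_single: "subst_poly h v (Poly_Mapping.single m a) = h a * monomial_value v m"
  by (simp add: subst_poly_superset[of h "{m}"] zero)

lemma subst_poly_zero: "subst_poly h v 0 = 0"
  by (simp add: subst_poly_def)

lemma subst_poly_add: "subst_poly h v (p + q) = subst_poly h v p + subst_poly h v q"
proof -
  let ?A = "Poly_Mapping.keys p \<union> Poly_Mapping.keys q"
  have "Poly_Mapping.keys (p + q) \<subseteq> ?A"
    by (rule keys_add)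
  then show ?thesis
    by (simp add: subst_poly_superset[of h ?A] zero lookup_add add sum.distrib distrib_right)
qed

lemma subst_poly_sum: "subst_poly h v (sum p A) = (\<Sum>i\<in>A. subst_poly h v (p i))"
  by (induction A rule: infinite_finite_induct) (simp_all add: subst_poly_zero subst_poly_add)

lemma subst_poly_mult: "subst_poly h v (p * q) = subst_poly h v p * subst_poly h v q"
proof -
  let ?s = "\<lambda>p m. Poly_Mapping.single m (Poly_Mapping.lookup p m)"
  let ?P = "Poly_Mapping.keys p" and ?Q = "Poly_Mapping.keys q"
  have "p * q = (\<Sum>m\<in>?P. \<Sum>n\<in>?Q. ?s p m * ?s q n)"
    by (subst poly_mapping_eq_sum_single[of p], subst poly_mapping_eq_sum_single[of q])
      (simp add: sum_product)
  then have "subst_poly h v (p * q) =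
      (\<Sum>m\<in>?P. \<Sum>n\<in>?Q. subst_poly h v (?s p m) * subst_poly h v (?s q n))"
    by (simp add: subst_poly_sum mult_single subst_poly_single mult monomial_value_add ac_simps)
  also have "\<dots> = subst_poly h v p * subst_poly h v q"
    unfolding sum_product [symmetric] subst_poly_single by (simp add: subst_poly_def)
  finally show ?thesis .
qed

lemma subst_poly_Const: "subst_poly h v (Const a) = h a"
  by (simp add: Const_def subst_poly_single)

lemma subst_poly_monom_of: "subst_poly h v (monom_of m) = monomial_value v m"
  by (simp add: monom_of_def subst_poly_single one)

lemma subst_poly_power: "subst_poly h v (p ^ n) = subst_poly h v p ^ n"
proof (induction n)
  case 0
  show ?case
    using subst_poly_single[of v 0 1] by (simp add: one)
qed (simp add: subst_poly_mult)

lemma subst_poly_prod: "subst_poly h v (prod p A) = (\<Prod>i\<in>A. subst_poly h v (p i))"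
proof -
  have "subst_poly h v 1 = 1"
    using subst_poly_power[of v 1 0] by simp
  then show ?thesis
    by (induction A rule: infinite_finite_induct) (simp_all add: subst_poly_mult)
qed

end

interpretation complex_coeff: coefficient_hom "\<lambda>a::complex. a"
  by standard simp_all

interpretation poly_coeff: coefficient_hom "Const :: complex \<Rightarrow> 'y cpoly"
  by standard (simp_all add: Const_def single_add mult_single)

lemma eval_poly_eq_subst_poly: "eval_poly v = subst_poly (\<lambda>a. a) v"
  by (simp add: fun_eq_iff eval_poly_def subst_poly_def monomial_value_def)

text \<open>Links algebra and geometry: the image of \<open>p\<close> under a monomial map,
  evaluated at parameters \<open>w\<close>, is \<open>p\<close> evaluated at the point which
  \<open>w\<close> parametrizes.\<close>

lemma eval_poly_subst_poly_Const:
  "eval_poly w (subst_poly Const g p) = eval_poly (\<lambda>x. eval_poly w (g x)) p"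
  unfolding eval_poly_eq_subst_poly subst_poly_def[of Const] subst_poly_def[of _ _ p]
    monomial_value_def
  by (simp add: complex_coeff.subst_poly_sum complex_coeff.subst_poly_mult complex_coeff.subst_poly_Const
      complex_coeff.subst_poly_prod complex_coeff.subst_poly_power)

lemma poly_ring_add: "p \<in> poly_ring Y \<Longrightarrow> q \<in> poly_ring Y \<Longrightarrow> p + q \<in> poly_ring Y"
  using keys_add[of p q] by (auto simp: poly_ring_def)

lemma poly_ring_mult:
  assumes "p \<in> poly_ring Y" "q \<in> poly_ring Y"
  shows "p * q \<in> poly_ring Y"
proof -
  have "Poly_Mapping.keys m \<subseteq> Y" if m: "m \<in> Poly_Mapping.keys (p * q)" for m
  proof -
    obtain a b where "a \<in> Poly_Mapping.keys p" "b \<in> Poly_Mapping.keys q" "m = a + b"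
      using m keys_mult[of p q] by blast
    with assms keys_add[of a b] show ?thesis
      unfolding poly_ring_def by blast
  qed
  then show ?thesis by (simp add: poly_ring_def)
qed

lemma poly_ring_Const: "Const a \<in> poly_ring Y"
  by (simp add: poly_ring_def Const_def)

lemma poly_ring_one: "1 \<in> poly_ring Y"
  using poly_ring_Const[of 1] by (simp add: Const_def)

lemma poly_ring_zero: "0 \<in> poly_ring Y"
  by (simp add: poly_ring_def)

lemma poly_ring_sum: "(\<And>i. i \<in> A \<Longrightarrow> p i \<in> poly_ring Y) \<Longrightarrow> sum p A \<in> poly_ring Y"
  by (induction A rule: infinite_finite_induct) (auto simp: poly_ring_zero poly_ring_add)

lemma poly_ring_prod: "(\<And>i. i \<in> A \<Longrightarrow> p i \<in> poly_ring Y) \<Longrightarrow> prod p A \<in> poly_ring Y"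
  by (induction A rule: infinite_finite_induct) (auto simp: poly_ring_one poly_ring_mult)

lemma poly_ring_power: "p \<in> poly_ring Y \<Longrightarrow> p ^ n \<in> poly_ring Y"
  by (induction n) (auto simp: poly_ring_one poly_ring_mult)

lemma poly_ring_subst_poly:
  "(\<And>x. g x \<in> poly_ring Y) \<Longrightarrow> subst_poly Const g p \<in> poly_ring Y"
  unfolding subst_poly_def monomial_value_def
  by (intro poly_ring_sum poly_ring_mult poly_ring_Const poly_ring_prod poly_ring_power)

section \<open>A criterion for toric ideals\<close>

text \<open>\<open>None\<close> encodes a variable sent to zero, \<open>Some k\<close> one sent to
  the monomial with exponents \<open>k\<close>.\<close>

definition opt_monomial :: "('y::finite \<Rightarrow> complex) \<Rightarrow> ('y \<Rightarrow> nat) option \<Rightarrow> complex" where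
  "opt_monomial w k = (case k of None \<Rightarrow> 0 | Some k \<Rightarrow> \<Prod>y\<in>UNIV. w y ^ k y)"

text \<open>If the image of \<open>p\<close> is zero, then \<open>p\<close> vanishes at every
  parametrized point, hence on \<open>V\<close>. Conversely, vanishing on \<open>V\<close> makes the
  image vanish on \<open>G\<close>, where distinct monomials are linearly independent. Thus
  \<open>G\<close> need not parametrize all of \<open>V\<close>.\<close>

lemma toric_if_monomial_parametrization:
  fixes G :: "('y::finite \<Rightarrow> complex) set" and \<mu> :: "'x \<Rightarrow> ('y \<Rightarrow> nat) option"
  assumes closed: "\<And>v w. v \<in> G \<Longrightarrow> w \<in> G \<Longrightarrow> (\<lambda>y. v y * w y) \<in> G"
    and separating: "\<And>k k'. k \<noteq> k' \<Longrightarrow> \<exists>w\<in>G. opt_monomial w (Some k) \<noteq> opt_monomial w (Some k')"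
    and nonzero: "\<exists>w\<in>G. \<forall>y. w y \<noteq> 0"
    and inside: "\<And>v. v \<in> V \<Longrightarrow> \<exists>w. \<forall>x. v x = opt_monomial w (\<mu> x)"
    and dense: "\<And>w. w \<in> G \<Longrightarrow> (\<lambda>x. opt_monomial w (\<mu> x)) \<in> V"
  shows "toric X {p \<in> poly_ring X. \<forall>v\<in>V. eval_poly v p = 0}"
proof -
  \<comment> \<open>The target variables in \<open>toric\<close> are natural numbers, so the
    parameters are numbered; \<open>dec\<close> carries assignments over to the numbers.\<close>
  obtain enc :: "'y \<Rightarrow> nat" where enc: "inj enc"
    using finite_imp_inj_to_nat_seg[of "UNIV :: 'y set"] by auto
  define Y where "Y = range enc"
  define dec where "dec w n = (w (inv enc n) :: complex)" for w n
  define mon where "mon k = (\<Sum>y\<in>UNIV. Poly_Mapping.single (enc y) (k y))" for k :: "'y \<Rightarrow> nat"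
  define g where "g x = (case \<mu> x of None \<Rightarrow> 0 | Some k \<Rightarrow> monom_of (mon k))" for x
  let ?\<phi> = "subst_poly Const g"
  have dec_enc: "dec w (enc y) = w y" for w y
    using enc by (simp add: dec_def)
  have keys_mon: "Poly_Mapping.keys (mon k) \<subseteq> Y" for k
    using keys_sum[of "\<lambda>y. Poly_Mapping.single (enc y) (k y)" UNIV]
    by (auto simp: mon_def Y_def split: if_splits)
  have value_Y: "monomial_value (dec w) m = opt_monomial w (Some (\<lambda>y. Poly_Mapping.lookup m (enc y)))"
    if "Poly_Mapping.keys m \<subseteq> Y" for w m
    using that enc
    by (simp add: monomial_value_superset[of Y] Y_def prod.reindex dec_enc opt_monomial_def)
  have lookup_mon: "Poly_Mapping.lookup (mon k) (enc y) = k y" for k y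
    using enc by (simp add: mon_def lookup_sum lookup_single when_def inj_eq)
  have eval_g: "eval_poly (dec w) (g x) = opt_monomial w (\<mu> x)" for w x
  proof (cases "\<mu> x")
    case None
    then show ?thesis
      by (simp add: g_def eval_poly_def opt_monomial_def)
  next
    case (Some k)
    then show ?thesis
      by (simp add: g_def eval_poly_eq_subst_poly complex_coeff.subst_poly_monom_of value_Y keys_mon lookup_mon)
  qed
  have eval_\<phi>: "eval_poly (dec w) (?\<phi> p) = eval_poly (\<lambda>x. opt_monomial w (\<mu> x)) p" for w p
    by (simp add: eval_poly_subst_poly_Const eval_g)
  have g_ring: "g x \<in> poly_ring Y" for x
    using keys_mon by (auto simp: g_def poly_ring_def monom_of_def split: option.split)
  \<comment> \<open>The monomials of \<open>q\<close> are pairwise distinct characters of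
    \<open>G\<close>, and the coefficients of \<open>q\<close> form a linear relation among
    them.\<close>
  have zero: "q = 0" if q: "q \<in> poly_ring Y" and vanish: "\<And>w. w \<in> G \<Longrightarrow> eval_poly (dec w) q = 0" for q
  proof -
    have "Poly_Mapping.lookup q m = 0" if m: "m \<in> Poly_Mapping.keys q" for m
    proof (rule sum_independent_characters
        [where M = "Poly_Mapping.keys q" and G = G and op = "\<lambda>v w y. v y * w y"
           and ch = "\<lambda>m w. monomial_value (dec w) m"])
      show "(\<lambda>y. v y * w y) \<in> G \<and> monomial_value (dec (\<lambda>y. v y * w y)) m =
          monomial_value (dec v) m * monomial_value (dec w) m" if "v \<in> G" "w \<in> G" for m v w
        using closed[OF that]
        by (simp add: monomial_value_def dec_def power_mult_distrib prod.distrib)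
      show "\<exists>w\<in>G. monomial_value (dec w) m \<noteq> monomial_value (dec w) m'"
        if m: "m \<in> Poly_Mapping.keys q" "m' \<in> Poly_Mapping.keys q" and "m \<noteq> m'" for m m'
      proof -
        have Y: "Poly_Mapping.keys m \<subseteq> Y" "Poly_Mapping.keys m' \<subseteq> Y"
          using m q by (auto simp: poly_ring_def)
        obtain n where n: "Poly_Mapping.lookup m n \<noteq> Poly_Mapping.lookup m' n"
          using \<open>m \<noteq> m'\<close> by (meson poly_mapping_eqI)
        then have "n \<in> Y"
          using Y by (metis in_keys_iff subsetD)
        with n have "(\<lambda>y. Poly_Mapping.lookup m (enc y)) \<noteq> (\<lambda>y. Poly_Mapping.lookup m' (enc y))"
          by (auto simp: Y_def fun_eq_iff)
        from separating[OF this] show ?thesis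
          by (simp add: value_Y Y)
      qed
      show "\<exists>w\<in>G. monomial_value (dec w) m \<noteq> 0" for m
        using nonzero by (auto simp: monomial_value_def dec_def)
      show "(\<Sum>m\<in>Poly_Mapping.keys q. Poly_Mapping.lookup q m * monomial_value (dec w) m) = 0"
        if "w \<in> G" for w
        using vanish[OF that] by (simp add: eval_poly_def monomial_value_def)
    qed (use m in simp_all)
    then show ?thesis
      by (metis in_keys_iff lookup_zero poly_mapping_eqI)
  qed
  have "monomial_map X Y ?\<phi>"
    unfolding monomial_map_def poly_hom_def
  proof (intro conjI ballI allI)
    fix x
    show "?\<phi> (Var x) = 0 \<or> (\<exists>m. ?\<phi> (Var x) = monom_of m)"
      by (auto simp: Var_def poly_coeff.subst_poly_monom_of g_def split: option.split)
  qed (simp_all add: poly_ring_subst_poly g_ring poly_coeff.subst_poly_Const poly_coeff.subst_poly_add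
      poly_coeff.subst_poly_mult)
  moreover have "(\<forall>v\<in>V. eval_poly v p = 0) \<longleftrightarrow> ?\<phi> p = 0" for p
  proof
    assume V: "\<forall>v\<in>V. eval_poly v p = 0"
    show "?\<phi> p = 0"
      using V dense by (intro zero) (auto simp: poly_ring_subst_poly g_ring eval_\<phi>)
  next
    assume "?\<phi> p = 0"
    then have "eval_poly (\<lambda>x. opt_monomial w (\<mu> x)) p = 0" for w
      using eval_\<phi>[of w p] by (simp add: eval_poly_def)
    moreover have "\<exists>w. v = (\<lambda>x. opt_monomial w (\<mu> x))" if "v \<in> V" for v
      using inside[OF that] by (auto simp: fun_eq_iff)
    ultimately show "\<forall>v\<in>V. eval_poly v p = 0"
      by metis
  qed
  ultimately show ?thesis
    unfolding toric_def by (intro exI[of _ Y] exI[of _ ?\<phi>]) (simp add: Y_def)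
qed

section \<open>Moments as monomials\<close>

definition edge_matrix :: "('v \<times> 'v) set \<Rightarrow> ('v \<times> 'v \<Rightarrow> real) \<Rightarrow> real^'v^'v" where
  "edge_matrix E f = (\<chi> u v. if (u, v) \<in> E then f (u, v) else 0)"

definition common_anc :: "('v \<times> 'v) set \<Rightarrow> 'v set \<Rightarrow> 'v set" where
  "common_anc E I = {a. \<forall>i\<in>I. (a, i) \<in> E\<^sup>*}"

text \<open>Only meaningful on polytrees and when \<open>common_anc E I\<close> is nonempty.\<close>

definition top_anc :: "('v \<times> 'v) set \<Rightarrow> 'v set \<Rightarrow> 'v" where
  "top_anc E I = (SOME t. common_anc E I = {a. (a, t) \<in> E\<^sup>*})"

section \<open>The path matrix and the diagonal moments\<close>

context
  fixes E :: "('v::finite \<times> 'v) set"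
  assumes polytree: "polytree E"
begin

text \<open>The recursion for path products is the left inverse equation. For square matrices the
  right one follows, and uniqueness of the inverse determines the choice made by
  \<open>matrix_inv\<close>.\<close>

lemma path_matrix_inverse:
  defines "M f \<equiv> (\<chi> a i. path_prod E f a i)"
  shows "M f ** (mat 1 - edge_matrix E f) = mat 1" "(mat 1 - edge_matrix E f) ** M f = mat 1"
    "matrix_inv (mat 1 - edge_matrix E f) = M f"
proof -
  have "(M f ** (mat 1 - edge_matrix E f)) $ a $ i = mat 1 $ a $ i" for a i
  proof -
    have "(M f ** (mat 1 - edge_matrix E f)) $ a $ i =
        path_prod E f a i - (\<Sum>u\<in>UNIV. path_prod E f a u * (if (u, i) \<in> E then f (u, i) else 0))"
    proof -
      have "path_prod E f a u * ((if u = i then 1 else 0) - (if (u, i) \<in> E then f (u, i) else 0)) =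
          (if u = i then path_prod E f a u else 0)
          - path_prod E f a u * (if (u, i) \<in> E then f (u, i) else 0)" for u
        by (simp add: right_diff_distrib)
      then show ?thesis
        by (simp add: M_def matrix_matrix_mult_def mat_def edge_matrix_def sum_subtractf
            del: mult_if_delta)
    qed
    also have "(\<Sum>u\<in>UNIV. path_prod E f a u * (if (u, i) \<in> E then f (u, i) else 0)) =
        (\<Sum>u | (u, i) \<in> E. path_prod E f a u * f (u, i))"
      by (intro sum.mono_neutral_cong_right) auto
    finally show ?thesis
      using path_prod_recursion[OF polytree, of f a i] by (simp add: mat_def)
  qed
  then show left: "M f ** (mat 1 - edge_matrix E f) = mat 1"
    by (simp add: vec_eq_iff)
  then show right: "(mat 1 - edge_matrix E f) ** M f = mat 1"
    by (simp add: matrix_left_right_inverse)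
  show "matrix_inv (mat 1 - edge_matrix E f) = M f"
    unfolding matrix_inv_def
  proof (rule some_equality)
    fix B
    assume B: "(mat 1 - edge_matrix E f) ** B = mat 1 \<and> B ** (mat 1 - edge_matrix E f) = mat 1"
    have "B = (M f ** (mat 1 - edge_matrix E f)) ** B"
      by (simp add: left)
    also have "\<dots> = M f"
      by (simp add: B flip: matrix_mul_assoc)
    finally show "B = M f" .
  qed (simp add: left right)
qed

lemma top_anc:
  assumes "I \<noteq> {}" "common_anc E I \<noteq> {}"
  shows "common_anc E I = {a. (a, top_anc E I) \<in> E\<^sup>*}"
proof -
  have "\<exists>t. common_anc E I = {a. (a, t) \<in> E\<^sup>*}"
    using common_ancestors[OF polytree _ assms(1)] assms(2)
    by (auto simp: common_anc_def set_eq_iff)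
  then show ?thesis
    unfolding top_anc_def by (rule someI_ex)
qed

lemma top_anc_common: "I \<noteq> {} \<Longrightarrow> common_anc E I \<noteq> {} \<Longrightarrow> i \<in> I \<Longrightarrow> (top_anc E I, i) \<in> E\<^sup>*"
  using top_anc[of I] by (auto simp: common_anc_def)

text \<open>
  Every common ancestor reaches \<open>js\<close> through the top one \<open>t\<close>, so the path products from
  \<open>t\<close> factor out of the moment.
\<close>

lemma sum_path_prod_top:
  fixes w :: "'v \<Rightarrow> real"
  assumes "js \<noteq> []"
  shows "(\<Sum>a\<in>UNIV. w a * prod_list (map (path_prod E f a) js)) =
    (if common_anc E (set js) = {} then 0
     else let t = top_anc E (set js) in
       (\<Sum>a\<in>UNIV. w a * path_prod E f a t ^ length js) * prod_list (map (path_prod E f t) js))"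
proof -
  \<comment> \<open>An index that \<open>a\<close> does not reach contributes a zero factor.\<close>
  have zero: "prod_list (map (path_prod E f a) js) = 0" if "a \<notin> common_anc E (set js)" for a
    using that by (auto simp: common_anc_def prod_list_zero_iff path_prod_def image_iff)
  show ?thesis
  proof (cases "common_anc E (set js) = {}")
    case True
    then show ?thesis using zero by simp
  next
    case False
    define t where "t = top_anc E (set js)"
    have anc: "common_anc E (set js) = {a. (a, t) \<in> E\<^sup>*}"
      unfolding t_def using assms False by (intro top_anc) auto
    have t: "(t, j) \<in> E\<^sup>*" if "j \<in> set js" for j
      using top_anc_common[of "set js" j] assms False that by (auto simp: t_def)
    have factor: "prod_list (map (path_prod E f a) js) =
        path_prod E f a t ^ length js * prod_list (map (path_prod E f t) js)" for a
    proof (cases "(a, t) \<in> E\<^sup>*")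
      case True
      have "prod_list (map (path_prod E f a) ks) =
          path_prod E f a t ^ length ks * prod_list (map (path_prod E f t) ks)"
        if "set ks \<subseteq> set js" for ks
        using that
      proof (induction ks)
        case (Cons k ks)
        then have "path_prod E f a k = path_prod E f a t * path_prod E f t k"
          using True t by (intro path_prod_trans[OF polytree]) auto
        with Cons show ?case by simp
      qed simp
      then show ?thesis by simp
    next
      case False
      \<comment> \<open>Both sides vanish: \<open>a\<close> is no common ancestor, and the zero on
        the right has a positive exponent because \<open>js\<close> is nonempty.\<close>
      then show ?thesis
        using zero[of a] assms by (simp add: anc path_prod_def power_0_left)
    qed
    have "(\<Sum>a\<in>UNIV. w a * prod_list (map (path_prod E f a) js)) =
        (\<Sum>a\<in>UNIV. w a * (path_prod E f a t ^ length js * prod_list (map (path_prod E f t) js)))"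
      by (intro sum.cong refl arg_cong[where f = "(*) (w _)"] factor)
    with False show ?thesis
      by (simp add: t_def [symmetric] Let_def sum_distrib_right mult.assoc)
  qed
qed

text \<open>Shows which error moments produce prescribed diagonal moments \<open>g\<close> of order
  \<open>n\<close>. The entrywise \<open>n\<close>-th power of the path matrix is the path matrix
  for the \<open>n\<close>-th powers of \<open>f\<close>, so \<open>g\<close> is multiplied by
  \<open>1 - ?F\<close> and then by its inverse.\<close>

lemma sum_path_prod_diagonal:
  fixes g :: "'v \<Rightarrow> real"
  assumes "n > 0"
  shows "(\<Sum>a\<in>UNIV. (g a - (\<Sum>u | (u, a) \<in> E. g u * f (u, a) ^ n)) * path_prod E f a t ^ n) = g t"
proof -
  let ?F = "edge_matrix E (\<lambda>e. f e ^ n)" and ?N = "\<chi> a i. path_prod E (\<lambda>e. f e ^ n) a i"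
  let ?g = "vec_lambda g"
  have *: "g a - (\<Sum>u | (u, a) \<in> E. g u * f (u, a) ^ n) = (?g v* (mat 1 - ?F)) $ a" for a
  proof -
    have "(\<Sum>u | (u, a) \<in> E. g u * f (u, a) ^ n) =
        (\<Sum>u\<in>UNIV. g u * (if (u, a) \<in> E then f (u, a) ^ n else 0))"
      by (intro sum.mono_neutral_cong_left) auto
    moreover have "g u * ((if u = a then 1 else 0) - (if (u, a) \<in> E then f (u, a) ^ n else 0)) =
        (if u = a then g u else 0) - g u * (if (u, a) \<in> E then f (u, a) ^ n else 0)" for u
      by (simp add: algebra_simps)
    ultimately show ?thesis
      by (simp add: vector_matrix_mult_def mat_def edge_matrix_def sum_subtractf)
  qed
  have "(\<Sum>a\<in>UNIV. (g a - (\<Sum>u | (u, a) \<in> E. g u * f (u, a) ^ n)) * path_prod E f a t ^ n) =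
      ((?g v* (mat 1 - ?F)) v* ?N) $ t"
    unfolding * by (simp add: vector_matrix_mult_def path_prod_power[OF polytree assms] mult.commute)
  also have "\<dots> = g t"
    by (simp add: vector_matrix_mul_assoc path_matrix_inverse)
  finally show ?thesis .
qed

end

text \<open>The variance and the third moment of each vertex, and the edge coefficients.\<close>

type_synonym 'v param = "'v + 'v + 'v \<times> 'v"

text \<open>\<open>tag\<close> decides whether the top vertex contributes its variance or its third
  moment. An edge counts once for every index whose path uses it, with repeated indices counted
  repeatedly. \<open>None\<close> stands for a moment that vanishes on the whole model.\<close>

definition trek_exponent ::
  "('v \<times> 'v) set \<Rightarrow> ('v \<Rightarrow> 'v param) \<Rightarrow> 'v list \<Rightarrow> ('v param \<Rightarrow> nat) option" where
  "trek_exponent E tag js = (if common_anc E (set js) = {} then None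
     else let t = top_anc E (set js) in
       Some (\<lambda>y. of_bool (y = tag t) +
         (case y of Inr (Inr e) \<Rightarrow> (\<Sum>j\<leftarrow>js. of_bool (e \<in> path_edges E t j)) | _ \<Rightarrow> 0)))"

fun moment_exponent :: "('v \<times> 'v) set \<Rightarrow> 'v moment_var \<Rightarrow> ('v param \<Rightarrow> nat) option" where
  "moment_exponent E (s_var i j) = trek_exponent E Inl [i, j]"
| "moment_exponent E (t_var i j k) = trek_exponent E (\<lambda>v. Inr (Inl v)) [i, j, k]"

lemma prod_of_bool_power:
  fixes w :: "'y \<Rightarrow> 'a::comm_semiring_1"
  assumes "finite A"
  shows "(\<Prod>y\<in>A. w y ^ of_bool (y \<in> B)) = (\<Prod>y\<in>A \<inter> B. w y)"
  using assms by (simp add: prod.inter_restrict of_bool_def if_distrib cong: if_cong)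

lemma prod_param:
  fixes h :: "'v::finite param \<Rightarrow> 'a::comm_monoid_mult"
  shows "(\<Prod>y\<in>UNIV. h y) = (\<Prod>v\<in>UNIV. h (Inl v)) * (\<Prod>v\<in>UNIV. h (Inr (Inl v))) *
    (\<Prod>e\<in>UNIV. h (Inr (Inr e)))"
  by (simp add: UNIV_Plus_UNIV [symmetric] prod.Plus mult.assoc del: UNIV_Plus_UNIV)

section \<open>Model points and their monomial parameters\<close>

context
  fixes E :: "('v::finite \<times> 'v) set"
  assumes polytree: "polytree E"
begin

text \<open>Brings the monomial into the shape of \<open>sum_path_prod_top\<close>, for comparison
  with a moment factor by factor.\<close>

lemma opt_monomial_trek_exponent:
  assumes "js \<noteq> []"
  shows "opt_monomial w (trek_exponent E tag js) =
    (if common_anc E (set js) = {} then 0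
     else let t = top_anc E (set js) in
       w (tag t) * prod_list (map (path_prod E (\<lambda>e. w (Inr (Inr e))) t) js))"
proof (cases "common_anc E (set js) = {}")
  case True
  then show ?thesis by (simp add: opt_monomial_def trek_exponent_def)
next
  case False
  define t where "t = top_anc E (set js)"
  let ?f = "\<lambda>e. w (Inr (Inr e))"
  \<comment> \<open>Sorts the edge factors by index: each index contributes the product over its own
    path, which exists because \<open>t\<close> is a common ancestor.\<close>
  have path: "(\<Prod>e\<in>UNIV. ?f e ^ (\<Sum>j\<leftarrow>ks. of_bool (e \<in> path_edges E t j))) =
      prod_list (map (path_prod E ?f t) ks)" if "set ks \<subseteq> set js" for ks
    using that
  proof (induction ks)
    case (Cons k ks)
    have "(t, k) \<in> E\<^sup>*"
      using Cons.prems top_anc_common[OF polytree, of "set js" k] assms False by (auto simp: t_def)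
    with Cons show ?case
      by (simp add: power_add prod.distrib prod_of_bool_power path_prod_def)
  qed simp
  have "opt_monomial w (trek_exponent E tag js) =
      (\<Prod>y\<in>UNIV. w y ^ of_bool (y = tag t)) *
      (\<Prod>y\<in>UNIV. w y ^ (case y of Inr (Inr e) \<Rightarrow> (\<Sum>j\<leftarrow>js. of_bool (e \<in> path_edges E t j)) | _ \<Rightarrow> 0))"
    using False by (simp add: opt_monomial_def trek_exponent_def t_def [symmetric] Let_def
        power_add prod.distrib)
  also have "(\<Prod>y\<in>UNIV. w y ^ of_bool (y = tag t)) = w (tag t)"
    using prod_of_bool_power[of UNIV w "{tag t}"] by simp
  also have "(\<Prod>y\<in>UNIV. w y ^ (case y of Inr (Inr e) \<Rightarrow> (\<Sum>j\<leftarrow>js. of_bool (e \<in> path_edges E t j)) | _ \<Rightarrow> 0)) =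
      prod_list (map (path_prod E ?f t) js)"
    by (simp add: prod_param path)
  finally show ?thesis
    using False by (simp add: t_def Let_def)
qed


text \<open>Diagonality of the error moments collapses the multiple sums to one over a common source
  \<open>a\<close>.\<close>

lemma moment_model_entries:
  assumes M: "M = (\<chi> a i. path_prod E f a i)"
    and \<Omega>2: "diagonal_matrix \<Omega>2" and \<Omega>3: "diagonal_tensor \<Omega>3"
  shows "(transpose M ** \<Omega>2 ** M) $ i $ j =
      (\<Sum>a\<in>UNIV. \<Omega>2 $ a $ a * prod_list (map (path_prod E f a) [i, j]))"
    and "tucker \<Omega>3 M M M $ i $ j $ k =
      (\<Sum>a\<in>UNIV. \<Omega>3 $ a $ a $ a * prod_list (map (path_prod E f a) [i, j, k]))"
proof -
  have 2: "z b * \<Omega>2 $ b $ a = (if b = a then z a * \<Omega>2 $ a $ a else 0)" for z :: "'v \<Rightarrow> real" and a b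
    using \<Omega>2 by (auto simp: diagonal_matrix_def)
  have "(\<Sum>b\<in>UNIV. path_prod E f b i * \<Omega>2 $ b $ a) = path_prod E f a i * \<Omega>2 $ a $ a" for a
    by (subst 2) simp
  then show "(transpose M ** \<Omega>2 ** M) $ i $ j =
      (\<Sum>a\<in>UNIV. \<Omega>2 $ a $ a * prod_list (map (path_prod E f a) [i, j]))"
    by (simp add: M matrix_matrix_mult_def transpose_def ac_simps)
  have 3: "\<Omega>3 $ a $ b $ c * z = (if c = a then (if b = a then \<Omega>3 $ a $ a $ a * z else 0) else 0)"
    for a b c z
    using \<Omega>3 by (auto simp: diagonal_tensor_def)
  show "tucker \<Omega>3 M M M $ i $ j $ k =
      (\<Sum>a\<in>UNIV. \<Omega>3 $ a $ a $ a * prod_list (map (path_prod E f a) [i, j, k]))"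
    by (simp add: M tucker_def mult.assoc) (subst 3, simp)
qed

lemma path_prod_of_real:
  "path_prod E (\<lambda>e. of_real (f e) :: complex) a i = of_real (path_prod E f a i)"
  by (simp add: path_prod_def)

text \<open>Covers both orders at once: \<open>w\<close> holds the error moments, and the parameter
  at \<open>tag t\<close> is the diagonal moment that \<open>sum_path_prod_top\<close> pulls
  out.\<close>

lemma path_moment_monomial:
  fixes w :: "'v \<Rightarrow> real" and f :: "'v \<times> 'v \<Rightarrow> real"
  assumes "js \<noteq> []" "\<And>e. v (Inr (Inr e)) = of_real (f e)"
    and "\<And>t. v (tag t) = of_real (\<Sum>a\<in>UNIV. w a * path_prod E f a t ^ length js)"
  shows "of_real (\<Sum>a\<in>UNIV. w a * prod_list (map (path_prod E f a) js)) =
    opt_monomial v (trek_exponent E tag js)"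
proof -
  have "of_real (prod_list (map (path_prod E f t) ks)) =
      prod_list (map (path_prod E (\<lambda>e. v (Inr (Inr e))) t) ks)" for t ks
    by (induction ks) (simp_all add: assms(2) path_prod_of_real)
  then show ?thesis
    unfolding opt_monomial_trek_exponent[OF assms(1)] sum_path_prod_top[OF polytree assms(1)]
    by (simp add: Let_def assms(3))
qed

lemma moment_entry_monomial:
  assumes M: "M = (\<chi> a i. path_prod E f a i)"
    and \<Omega>2: "diagonal_matrix \<Omega>2" and \<Omega>3: "diagonal_tensor \<Omega>3"
    and "\<And>e. v (Inr (Inr e)) = of_real (f e)"
    and "\<And>t. v (Inl t) = of_real (\<Sum>a\<in>UNIV. \<Omega>2 $ a $ a * path_prod E f a t ^ 2)"
    and "\<And>t. v (Inr (Inl t)) = of_real (\<Sum>a\<in>UNIV. \<Omega>3 $ a $ a $ a * path_prod E f a t ^ 3)"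
  shows "moment_entry (transpose M ** \<Omega>2 ** M) (tucker \<Omega>3 M M M) x =
    opt_monomial v (moment_exponent E x)"
proof (cases x)
  case (s_var i j)
  show ?thesis
    unfolding s_var moment_entry.simps moment_exponent.simps moment_model_entries[OF M \<Omega>2 \<Omega>3]
    by (rule path_moment_monomial) (simp_all add: assms(4,5) power2_eq_square)
next
  case (t_var i j k)
  have "length [i, j, k] = 3" by simp
  show ?thesis
    unfolding t_var moment_entry.simps moment_exponent.simps moment_model_entries[OF M \<Omega>2 \<Omega>3]
    by (rule path_moment_monomial) (simp_all only: assms(4,6) \<open>length [i, j, k] = 3\<close>, simp)
qed

text \<open>The parameters of a model point are its own diagonal moments and edge
  coefficients.\<close>

lemma moment_model_monomial:
  assumes "(S, T) \<in> moment_model E"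
  shows "\<exists>v. \<forall>x. moment_entry S T x = opt_monomial v (moment_exponent E x)"
proof -
  obtain \<Lambda> \<Omega>2 \<Omega>3 where \<Lambda>: "\<Lambda> \<in> edge_matrices E"
    and diag: "diagonal_matrix \<Omega>2" "diagonal_tensor \<Omega>3"
    and S: "S = transpose (matrix_inv (mat 1 - \<Lambda>)) ** \<Omega>2 ** matrix_inv (mat 1 - \<Lambda>)"
    and T: "T = tucker \<Omega>3 (matrix_inv (mat 1 - \<Lambda>)) (matrix_inv (mat 1 - \<Lambda>)) (matrix_inv (mat 1 - \<Lambda>))"
    using assms by (auto simp: moment_model_def)
  define f where "f = (\<lambda>(u, v). \<Lambda> $ u $ v)"
  have "\<Lambda> = edge_matrix E f"
    using \<Lambda> by (auto simp: vec_eq_iff edge_matrix_def edge_matrices_def f_def)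
  then have M: "matrix_inv (mat 1 - \<Lambda>) = (\<chi> a i. path_prod E f a i)"
    using path_matrix_inverse(3)[OF polytree] by simp
  show ?thesis
    unfolding S T
    by (rule exI[of _ "\<lambda>y. case y of
          Inl t \<Rightarrow> of_real (\<Sum>a\<in>UNIV. \<Omega>2 $ a $ a * path_prod E f a t ^ 2)
        | Inr (Inl t) \<Rightarrow> of_real (\<Sum>a\<in>UNIV. \<Omega>3 $ a $ a $ a * path_prod E f a t ^ 3)
        | Inr (Inr e) \<Rightarrow> of_real (f e)"], intro allI moment_entry_monomial[OF M diag]) simp_all
qed

lemma positive_definite_diagonal:
  fixes d :: "'v \<Rightarrow> real"
  assumes "\<And>a. d a > 0"
  shows "positive_definite (\<chi> a b. if a = b then d a else 0)"
proof -
  let ?D = "\<chi> a b. if a = b then d a else 0"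
  have "x \<bullet> (?D *v x) > 0" if "x \<noteq> 0" for x :: "real^'v"
  proof -
    obtain b where "x $ b \<noteq> 0"
      using \<open>x \<noteq> 0\<close> by (auto simp: vec_eq_iff)
    have "x \<bullet> (?D *v x) = (\<Sum>a\<in>UNIV. x $ a * (d a * x $ a))"
      by (simp add: inner_vec_def matrix_vector_mult_def if_distrib [of "\<lambda>z. z * _"] cong: if_cong)
    also have "\<dots> = (\<Sum>a\<in>UNIV. d a * (x $ a)\<^sup>2)"
      by (simp add: power2_eq_square ac_simps)
    also have "\<dots> > 0"
      using assms \<open>x $ b \<noteq> 0\<close> by (intro sum_pos2[of _ b]) (auto simp: less_imp_le)
    finally show ?thesis .
  qed
  then show ?thesis
    by (auto simp: positive_definite_def transpose_def vec_eq_iff)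
qed

text \<open>
  The variances \<open>g\<close> and the edge coefficients \<open>f\<close> come from a model point iff the error
  variances they force are positive; the third moments are unconstrained.
\<close>

lemma moment_model_realizes:
  fixes f :: "'v \<times> 'v \<Rightarrow> real" and g h :: "'v \<Rightarrow> real"
  assumes "\<And>a. (\<Sum>u | (u, a) \<in> E. g u * f (u, a) ^ 2) < g a"
    and v: "\<And>e. v (Inr (Inr e)) = of_real (f e)" "\<And>t. v (Inl t) = of_real (g t)"
      "\<And>t. v (Inr (Inl t)) = of_real (h t)"
  shows "\<exists>(S, T)\<in>moment_model E. \<forall>x. moment_entry S T x = opt_monomial v (moment_exponent E x)"
proof -
  \<comment> \<open>The error variances \<open>d\<close> and third error moments \<open>e\<close>
    are the ones that \<open>sum_path_prod_diagonal\<close> turns into \<open>g\<close> and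
    \<open>h\<close>.\<close>
  define d where "d a = g a - (\<Sum>u | (u, a) \<in> E. g u * f (u, a) ^ 2)" for a
  define e where "e a = h a - (\<Sum>u | (u, a) \<in> E. h u * f (u, a) ^ 3)" for a
  define M :: "real^'v^'v" where "M = (\<chi> a i. path_prod E f a i)"
  define \<Omega>2 :: "real^'v^'v" where "\<Omega>2 = (\<chi> a b. if a = b then d a else 0)"
  define \<Omega>3 :: "real^'v^'v^'v" where "\<Omega>3 = (\<chi> a b c. if a = b \<and> b = c then e a else 0)"
  have diag: "diagonal_matrix \<Omega>2" "diagonal_tensor \<Omega>3"
    by (auto simp: \<Omega>2_def \<Omega>3_def diagonal_matrix_def diagonal_tensor_def)
  have "positive_definite \<Omega>2"
    unfolding \<Omega>2_def using assms(1) by (intro positive_definite_diagonal) (simp add: d_def)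
  moreover have "symmetric_tensor \<Omega>3"
    by (auto simp: \<Omega>3_def symmetric_tensor_def)
  moreover have "edge_matrix E f \<in> edge_matrices E"
    by (simp add: edge_matrix_def edge_matrices_def)
  moreover have "matrix_inv (mat 1 - edge_matrix E f) = M"
    unfolding M_def by (rule path_matrix_inverse(3)[OF polytree])
  ultimately have "(transpose M ** \<Omega>2 ** M, tucker \<Omega>3 M M M) \<in> moment_model E"
    unfolding moment_model_def mem_Collect_eq case_prod_conv using diag
    by - (rule exI[of _ "edge_matrix E f"], rule exI[of _ \<Omega>2], rule exI[of _ \<Omega>3], simp)
  moreover have "moment_entry (transpose M ** \<Omega>2 ** M) (tucker \<Omega>3 M M M) x =
      opt_monomial v (moment_exponent E x)" for x
    using sum_path_prod_diagonal[OF polytree, of 2 g f] sum_path_prod_diagonal[OF polytree, of 3 h f]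
    by (intro moment_entry_monomial[OF M_def diag]) (simp_all add: v \<Omega>2_def \<Omega>3_def d_def e_def)
  ultimately show ?thesis by blast
qed

end

section \<open>The region of positive parameters\<close>

definition positive_params :: "('v::finite \<times> 'v) set \<Rightarrow> ('v param \<Rightarrow> real) set" where
  "positive_params E = {r. (\<forall>y. r y > 0) \<and>
     (\<forall>a. (\<Sum>u | (u, a) \<in> E. r (Inl u) * r (Inr (Inr (u, a))) ^ 2) < r (Inl a))}"

text \<open>For nonnegative terms the sum of products is at most the product of the sums, and the
  two strict inequalities multiply.\<close>

lemma positive_params_mult:
  assumes r: "r \<in> positive_params E" and s: "s \<in> positive_params E"
  shows "(\<lambda>y. r y * s y) \<in> positive_params E"
proof -
  have pos: "r y > 0" "s y > 0" for y
    using r s by (auto simp: positive_params_def)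
  have "(\<Sum>u | (u, a) \<in> E. r (Inl u) * s (Inl u) * (r (Inr (Inr (u, a))) * s (Inr (Inr (u, a)))) ^ 2)
      < r (Inl a) * s (Inl a)" for a
  proof -
    let ?R = "\<lambda>u. r (Inl u) * r (Inr (Inr (u, a))) ^ 2"
    let ?S = "\<lambda>u. s (Inl u) * s (Inr (Inr (u, a))) ^ 2"
    let ?P = "{u. (u, a) \<in> E}"
    have nonneg: "?R u \<ge> 0" "?S u \<ge> 0" for u
      using pos by (simp_all add: less_imp_le)
    have "(\<Sum>u\<in>?P. ?R u * ?S u) \<le> (\<Sum>u\<in>?P. ?R u * sum ?S ?P)"
      using nonneg by (intro sum_mono mult_left_mono member_le_sum) auto
    also have "\<dots> = sum ?R ?P * sum ?S ?P"
      by (simp add: sum_distrib_right)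
    also have "\<dots> < r (Inl a) * s (Inl a)"
      using r s nonneg
      by (intro mult_strict_mono') (auto simp: positive_params_def intro: sum_nonneg)
    finally show ?thesis
      by (simp add: power_mult_distrib ac_simps)
  qed
  with pos show ?thesis
    by (simp add: positive_params_def)
qed

text \<open>A box inside the region, leaving room to vary any single coordinate. With
  \<open>n\<close> vertices the sum is at most \<open>n * 2 / (2 * n)^2 = 1 / (2 * n)\<close>, which
  is below 1 and hence below every variance.\<close>

lemma positive_params_box:
  fixes r :: "'v::finite param \<Rightarrow> real"
  assumes "\<And>y. r y > 0" "\<And>a. 1 \<le> r (Inl a)" "\<And>a. r (Inl a) \<le> 2"
    and "\<And>e. r (Inr (Inr e)) \<le> 1 / (2 * CARD('v))"
  shows "r \<in> positive_params E"
proof -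
  have "(\<Sum>u | (u, a) \<in> E. r (Inl u) * r (Inr (Inr (u, a))) ^ 2) < r (Inl a)" for a
  proof -
    have "(\<Sum>u | (u, a) \<in> E. r (Inl u) * r (Inr (Inr (u, a))) ^ 2)
        \<le> (\<Sum>u\<in>UNIV. r (Inl u) * r (Inr (Inr (u, a))) ^ 2)"
      using assms(1) by (intro sum_mono2) (auto simp: less_imp_le)
    also have "\<dots> \<le> (\<Sum>u\<in>(UNIV :: 'v set). 2 * (1 / (2 * CARD('v))) ^ 2)"
      using assms by (intro sum_mono mult_mono power_mono) (auto simp: less_imp_le)
    also have "\<dots> = 1 / (2 * CARD('v))"
      by (simp add: power2_eq_square)
    also have "\<dots> < 1"
    proof -
      have "real CARD('v) \<ge> 1"
        using zero_less_card_finite[where 'a='v] by linarith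
      then show ?thesis by (subst divide_less_eq_1_pos) linarith+
    qed
    also have "\<dots> \<le> r (Inl a)"
      by (rule assms)
    finally show ?thesis .
  qed
  with assms(1) show ?thesis
    by (simp add: positive_params_def)
qed

text \<open>Rescaling one coordinate \<open>y\<close> with \<open>k y \<noteq> k' y\<close> by a
  factor \<open>q\<close> multiplies the two monomials by different powers of \<open>q\<close>, so
  they cannot agree at both points.\<close>

lemma positive_params_separate:
  fixes k k' :: "'v::finite param \<Rightarrow> nat"
  assumes "k \<noteq> k'"
  shows "\<exists>r\<in>positive_params E. (\<Prod>y\<in>UNIV. r y ^ k y) \<noteq> (\<Prod>y\<in>UNIV. r y ^ k' y)"
proof (rule ccontr)
  assume "\<not> ?thesis"
  then have eq: "(\<Prod>y\<in>UNIV. r y ^ k y) = (\<Prod>y\<in>UNIV. r y ^ k' y)" if "r \<in> positive_params E" for r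
    using that by blast
  obtain y where y: "k y \<noteq> k' y"
    using assms by blast
  \<comment> \<open>The factor keeps the rescaled point in the box: edge coefficients start at their
    upper bound and are halved, while variances start at 1 and may be doubled.\<close>
  define q :: real where "q = (case y of Inr (Inr _) \<Rightarrow> 1 / 2 | _ \<Rightarrow> 2)"
  define r :: "'v param \<Rightarrow> real" where
    "r z = (case z of Inr (Inr _) \<Rightarrow> 1 / (2 * CARD('v)) | _ \<Rightarrow> 1)" for z
  define s where "s z = (if z = y then q else 1)" for z
  have r: "r \<in> positive_params E"
    by (rule positive_params_box) (auto simp: r_def split: sum.splits)
  have "(\<lambda>z. r z * s z) \<in> positive_params E"
    by (rule positive_params_box) (auto simp: r_def s_def q_def field_simps split: sum.splits)
  from eq[OF this] have "(\<Prod>z\<in>UNIV. r z ^ k z) * q ^ k y = (\<Prod>z\<in>UNIV. r z ^ k' z) * q ^ k' y"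
    by (simp add: power_mult_distrib prod.distrib s_def if_distrib [of "\<lambda>x. x ^ _"] cong: if_cong)
  also have "\<dots> = (\<Prod>z\<in>UNIV. r z ^ k z) * q ^ k' y"
    by (simp only: eq[OF r])
  finally have "(\<Prod>z\<in>UNIV. r z ^ k z) * q ^ k y = (\<Prod>z\<in>UNIV. r z ^ k z) * q ^ k' y" .
  moreover have "(\<Prod>z\<in>UNIV. r z ^ k z) \<noteq> 0"
    using r by (simp add: positive_params_def less_imp_neq [symmetric])
  ultimately have "q ^ k y = q ^ k' y"
    by (simp only: mult_left_cancel not_False_eq_True)
  moreover have "q > 0" "q \<noteq> 1"
    by (auto simp: q_def split: sum.splits)
  ultimately show False
    using y power_inject_exp'[of q "k y" "k' y"] by simp
qed

theorem corollary2p5: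
  fixes E :: "('v::{finite,linorder} \<times> 'v) set"
  assumes "polytree E"
  shows "toric moment_vars (moment_ideal E)"
proof -
  \<comment> \<open>\<open>?V\<close> views model points as assignments to the moment variables, and
    \<open>?G\<close> views the positive parameters as complex ones.\<close>
  let ?V = "(\<lambda>(S, T). moment_entry S T) ` moment_model E"
  let ?G = "(\<lambda>r y. complex_of_real (r y)) ` positive_params E"
  have real: "opt_monomial (\<lambda>y. complex_of_real (r y)) (Some k) =
      of_real (\<Prod>y\<in>UNIV. r y ^ k y)" for r :: "'v param \<Rightarrow> real" and k
    by (simp add: opt_monomial_def)
  have "toric moment_vars {p \<in> poly_ring moment_vars. \<forall>v\<in>?V. eval_poly v p = 0}"
  proof (rule toric_if_monomial_parametrization[where G = ?G and \<mu> = "moment_exponent E"])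
    fix v w
    assume "v \<in> ?G" "w \<in> ?G"
    then show "(\<lambda>y. v y * w y) \<in> ?G"
      using positive_params_mult[of _ E] by (force simp flip: of_real_mult)
  next
    fix k k' :: "'v param \<Rightarrow> nat"
    assume "k \<noteq> k'"
    then show "\<exists>w\<in>?G. opt_monomial w (Some k) \<noteq> opt_monomial w (Some k')"
      using positive_params_separate[of k k' E]
      by (simp only: bex_simps real of_real_eq_iff not_False_eq_True)
  next
    \<comment> \<open>Separating any two exponents shows that the region is nonempty; all
      coordinates of its points are positive.\<close>
    obtain r where r: "r \<in> positive_params E"
      using positive_params_separate[of "\<lambda>_. 0" "\<lambda>_. 1" E] by (auto simp: fun_eq_iff)
    show "\<exists>w\<in>?G. \<forall>y. w y \<noteq> 0"
    proof (intro bexI allI)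
      show "complex_of_real (r y) \<noteq> 0" for y
        using r by (simp add: positive_params_def less_imp_neq [symmetric])
    qed (rule imageI, rule r)
  next
    fix v
    assume "v \<in> ?V"
    then show "\<exists>w. \<forall>x. v x = opt_monomial w (moment_exponent E x)"
      using moment_model_monomial[OF assms] by auto
  next
    fix w
    assume "w \<in> ?G"
    then obtain r where r: "r \<in> positive_params E" "w = (\<lambda>y. complex_of_real (r y))"
      by blast
    then obtain S T where "(S, T) \<in> moment_model E"
      "\<forall>x. moment_entry S T x = opt_monomial w (moment_exponent E x)"
      using moment_model_realizes[OF assms, of "\<lambda>a. r (Inl a)" "\<lambda>e. r (Inr (Inr e))" w
          "\<lambda>a. r (Inr (Inl a))"]
      by (auto simp: positive_params_def)
    then show "(\<lambda>x. opt_monomial w (moment_exponent E x)) \<in> ?V"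
      by (intro image_eqI[of _ _ "(S, T)"]) (auto simp: fun_eq_iff)
  qed
  then show ?thesis
    by (simp add: moment_ideal_def case_prod_beta)
qed

end
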